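(* Let $k_1,\ldots,k_r\in\mathbb{Z}_{\ge0}$ with $(k_1,\ldots,k_r)\ne(0,\ldots,0)$. The function \[\widetilde{\xi}(-k_1,\ldots,-k_r;s)=\frac{1}{\Gamma(s)}\int_0^\infty t^{s-1}\frac{\mathrm{Li}_{-k_1,\ldots,-k_r}(1-e^t)}{e^{-t}-1}dt\qquad(\mathrm{Re}(s)>1-r)\] can be analytically continued to an entire function on the whole complex plane, and satisfies $\widetilde{\xi}(-k_1,\ldots,-k_r;-m)=C_m^{(-k_1,\ldots,-k_r)}$ for all $m\in\mathbb{Z}_{\ge0}$. In particular $\widetilde{\xi}(-k;-m)=C_m^{(-k)}$ for $k\in\mathbb{Z}_{\ge1}$, $m\in\mathbb{Z}_{\ge0}$.
   Context: For integers $k_i$, $\mathrm{Li}_{k_1,\ldots,k_r}(z)=\sum_{1\le m_1<\cdots<m_r}z^{m_r}/(m_1^{k_1}\cdots m_r^{k_r})$ for $|z|<1$; when all $k_i\le0$ this is a rational function of $z$ with poles only at $z=1$, and $\mathrm{Li}_{-k_1,\ldots,-k_r}(1-e^t)$ means this rational function evaluated at $1-e^t$. The numbers $C_n^{(-k_1,\ldots,-k_r)}$ are defined by $\frac{\mathrm{Li}_{-k_1,\ldots,-k_r}(1-e^{-t})}{e^{t}-1}=\sum_{n\ge0}C_n^{(-k_1,\ldots,-k_r)}\frac{t^n}{n!}$. *)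

theory Defs
  imports "HOL-Complex_Analysis.Complex_Analysis"
begin

text \<open>An index \<open>(k\<^sub>1, \<dots>, k\<^sub>r)\<close> is a list, so \<open>r\<close> is its length and \<open>k\<^sub>i\<close> is the
  list entry with number \<open>i - 1\<close>; a chain \<open>1 \<le> m\<^sub>1 < \<dots> < m\<^sub>r\<close> is encoded likewise.\<close>

definition increasing_chains :: "nat \<Rightarrow> nat list set" where
  "increasing_chains r = {ms. length ms = r \<and> sorted_wrt (<) ms \<and> (\<forall>m\<in>set ms. 1 \<le> m)}"

text \<open>Meaningful for a nonempty index and \<open>norm z < 1\<close>, where the series converges absolutely.\<close>

definition multi_polylog :: "int list \<Rightarrow> complex \<Rightarrow> complex" where
  "multi_polylog ks z =
     (\<Sum>\<^sub>\<infinity>ms\<in>increasing_chains (length ks).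
        z ^ last ms / (\<Prod>i<length ks. of_nat (ms ! i) powi (ks ! i)))"

text \<open>If all entries are \<open>\<le> 0\<close>, the series is on the unit disc a rational function with no pole
  other than \<open>1\<close>. The properties below determine that function everywhere except at \<open>1\<close>;
  its value there is irrelevant, since \<open>1 - exp t\<close> is never \<open>1\<close>.\<close>

definition multi_polylog_rational :: "int list \<Rightarrow> complex \<Rightarrow> complex" where
  "multi_polylog_rational ks =
     (SOME R. (\<exists>p N. \<forall>z. z \<noteq> 1 \<longrightarrow> R z = poly p z / (1 - z) ^ N) \<and>
              (\<forall>z. norm z < 1 \<longrightarrow> R z = multi_polylog ks z))"

text \<open>The generating function identity is required for all \<open>t\<close> in a punctured neighbourhood of
  \<open>0\<close>: the quotient has a removable singularity at \<open>0\<close>, where HOL division would yield \<open>0\<close>.\<close>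

definition multi_poly_bernoulli_C :: "int list \<Rightarrow> nat \<Rightarrow> complex" where
  "multi_poly_bernoulli_C ks =
     (THE c. \<forall>\<^sub>F t in at 0.
        (\<lambda>n. c n * t ^ n / fact n) sums
          (multi_polylog_rational ks (1 - exp (- t)) / (exp t - 1)))"

definition xi_tilde_integrand :: "int list \<Rightarrow> complex \<Rightarrow> real \<Rightarrow> complex" where
  "xi_tilde_integrand ks s t =
     of_real t powr (s - 1) *
       (multi_polylog_rational ks (1 - exp (of_real t)) / (exp (- of_real t) - 1))"

definition xi_tilde_integral :: "int list \<Rightarrow> complex \<Rightarrow> complex" where
  "xi_tilde_integral ks s =
     1 / Gamma s * (LINT t:{0<..}|lborel. xi_tilde_integrand ks s t)"

abbreviation neg_index :: "nat list \<Rightarrow> int list" where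
  "neg_index ks \<equiv> map (\<lambda>k. - int k) ks"

end

theory Submission
  imports Defs
begin

text \<open>Summing over the largest index last shows that the polylogarithm of index \<open>-k\<^sub>1, \<dots>, -k\<^sub>r\<close> is
  obtained from 1 by alternately multiplying by \<open>z / (1 - z)\<close> and applying \<open>z d/dz\<close>. In the variable
  \<open>u = 1 / (1 - z)\<close> these are multiplication by \<open>u - 1\<close> and \<open>u (u - 1) d/du\<close>, so it is a polynomial
  \<open>P u\<close>, divisible by \<open>(u - 1) ^ r\<close>, and by \<open>u\<close> as soon as one derivative occurs. With
  \<open>P u = (u - 1) q u\<close> the integrand is \<open>t powr (s - 1) * q (exp (- t))\<close>, and termwise integration gives
  the entire function \<open>\<Sum>j. q\<^sub>j j powr (- s)\<close>, whose value \<open>\<Sum>j. q\<^sub>j j ^ m\<close> at \<open>-m\<close> is the Taylor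
  coefficient of \<open>q (exp t)\<close>. The zero of order \<open>r - 1\<close> of \<open>q\<close> at 1 allows \<open>r - 1\<close> integrations by
  parts, which extend the integral formula to \<open>Re s > 1 - r\<close>.\<close>

section \<open>Chains sorted by their largest entry\<close>

text \<open>The prefixed 0 makes the empty chain end in 0, so that \<open>chains_to_Suc\<close> also covers \<open>r = 0\<close>.\<close>

definition chains_to :: "nat \<Rightarrow> nat \<Rightarrow> nat list set" where
  "chains_to r m = {ms \<in> increasing_chains r. last (0 # ms) = m}"

definition chain_weight :: "nat list \<Rightarrow> nat list \<Rightarrow> nat" where
  "chain_weight ks ms = (\<Prod>i<length ks. (ms ! i) ^ (ks ! i))"

definition chain_sum :: "nat list \<Rightarrow> nat \<Rightarrow> nat" where
  "chain_sum ks m = (\<Sum>ms\<in>chains_to (length ks) m. chain_weight ks ms)"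

text \<open>The variable is \<open>u = 1 / (1 - z)\<close>. With \<open>foldl\<close> the entry that
  belongs to the largest summation variable acts last.\<close>

definition polylog_poly :: "nat list \<Rightarrow> complex poly" where
  "polylog_poly ks =
     foldl (\<lambda>p k. ((\<lambda>q. [:0, -1, 1:] * pderiv q) ^^ k) ([:-1, 1:] * p)) 1 ks"

lemma chains_to_0: "chains_to 0 m = (if m = 0 then {[]} else {})"
  by (auto simp: chains_to_def increasing_chains_def)

lemma sorted_wrt_less_le_last:
  fixes ms :: "nat list"
  assumes "sorted_wrt (<) ms" "x \<in> set ms"
  shows "x \<le> last ms"
  using assms by (induction ms rule: rev_induct) (auto simp: sorted_wrt_append intro: less_imp_le)

text \<open>Deleting the last entry \<open>m\<close> leaves a chain that ends below
  \<open>m\<close>. For \<open>m = 0\<close> the union is empty, in accordance with the condition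
  that entries are at least 1.\<close>

lemma chains_to_Suc:
  "chains_to (Suc r) m = (\<lambda>ms. ms @ [m]) ` (\<Union>j<m. chains_to r j)"
proof (intro equalityI subsetI)
  fix xs assume xs: "xs \<in> chains_to (Suc r) m"
  then have "xs \<noteq> []" by (auto simp: chains_to_def increasing_chains_def)
  then obtain ms x where xs_eq: "xs = ms @ [x]" by (cases xs rule: rev_cases) auto
  with xs have "x = m" and ms: "ms \<in> increasing_chains r" "\<forall>y\<in>set ms. y < m" "1 \<le> m"
    by (auto simp: chains_to_def increasing_chains_def sorted_wrt_append)
  moreover have "last (0 # ms) < m"
    using ms by (cases ms rule: rev_cases) auto
  ultimately show "xs \<in> (\<lambda>ms. ms @ [m]) ` (\<Union>j<m. chains_to r j)"
    using xs_eq by (auto simp: chains_to_def)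
next
  fix xs assume "xs \<in> (\<lambda>ms. ms @ [m]) ` (\<Union>j<m. chains_to r j)"
  then obtain ms where ms: "xs = ms @ [m]" "ms \<in> increasing_chains r" "last (0 # ms) < m"
    by (auto simp: chains_to_def)
  have "y < m" if "y \<in> set ms" for y
    using sorted_wrt_less_le_last[of ms y] ms that
    by (auto simp: increasing_chains_def split: if_splits)
  then show "xs \<in> chains_to (Suc r) m"
    using ms by (auto simp: chains_to_def increasing_chains_def sorted_wrt_append)
qed

lemma finite_chains_to: "finite (chains_to r m)"
  by (induction r arbitrary: m) (auto simp: chains_to_0 chains_to_Suc)

lemma chain_sum_Nil: "chain_sum [] m = (if m = 0 then 1 else 0)"
  by (simp add: chain_sum_def chains_to_0 chain_weight_def)

lemma chain_weight_snoc:
  assumes "length ms = length ks"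
  shows "chain_weight (ks @ [k]) (ms @ [m]) = m ^ k * chain_weight ks ms"
  using assms by (simp add: chain_weight_def nth_append)

text \<open>Once the remaining chains are sorted by their own last entry \<open>j\<close>,
  \<open>m ^ k\<close> is a common factor. On power series the inner sum means multiplication by
  \<open>z / (1 - z)\<close>, and \<open>m ^ k\<close> means applying \<open>z d/dz\<close>
  \<open>k\<close> times.\<close>

lemma chain_sum_snoc: "chain_sum (ks @ [k]) m = m ^ k * (\<Sum>j<m. chain_sum ks j)"
proof -
  let ?r = "length ks"
  have "chain_sum (ks @ [k]) m =
      (\<Sum>ms\<in>(\<Union>j<m. chains_to ?r j). chain_weight (ks @ [k]) (ms @ [m]))"
    by (simp add: chain_sum_def chains_to_Suc sum.reindex inj_on_def)
  \<comment> \<open>The union is disjoint because a chain determines its last entry.\<close>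
  also have "\<dots> = (\<Sum>j<m. \<Sum>ms\<in>chains_to ?r j. chain_weight (ks @ [k]) (ms @ [m]))"
    by (intro sum.UNION_disjoint) (auto simp: finite_chains_to, auto simp: chains_to_def)
  also have "\<dots> = (\<Sum>j<m. \<Sum>ms\<in>chains_to ?r j. m ^ k * chain_weight ks ms)"
    by (intro sum.cong refl chain_weight_snoc) (auto simp: chains_to_def increasing_chains_def)
  finally show ?thesis
    by (simp add: chain_sum_def sum_distrib_left)
qed

lemma polylog_poly_Nil [simp]: "polylog_poly [] = 1"
  by (simp add: polylog_poly_def)

lemma polylog_poly_snoc:
  "polylog_poly (ks @ [k]) = ((\<lambda>q. [:0, -1, 1:] * pderiv q) ^^ k) ([:-1, 1:] * polylog_poly ks)"
  by (simp add: polylog_poly_def)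

section \<open>Power series of the chain sums on the unit disc\<close>

text \<open>Convergence at a radius between \<open>norm z\<close> and 1 forces absolute convergence
  at \<open>z\<close>.\<close>

lemma powser_abs_summable_in_unit_disc:
  fixes c :: "nat \<Rightarrow> complex"
  assumes "\<And>z. norm z < 1 \<Longrightarrow> summable (\<lambda>m. c m * z ^ m)" "norm z < 1"
  shows "summable (\<lambda>m. norm (c m * z ^ m))"
proof -
  obtain r where r: "norm z < r" "r < 1" using dense[OF assms(2)] by blast
  then have "norm (complex_of_real r) < 1" using norm_ge_zero[of z] by (simp del: norm_ge_zero)
  from powser_insidea[OF assms(1)[OF this], of z] show ?thesis using r by simp
qed

text \<open>The Cauchy product with the geometric series has the inclusive partial sums as
  coefficients; the factor \<open>z\<close> shifts them to the strict ones.\<close>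

lemma powser_partial_sums:
  fixes c :: "nat \<Rightarrow> complex"
  assumes c: "\<And>z. norm z < 1 \<Longrightarrow> (\<lambda>m. c m * z ^ m) sums f z" and z: "norm z < 1"
  shows "(\<lambda>m. (\<Sum>j<m. c j) * z ^ m) sums (z / (1 - z) * f z)"
proof -
  have "(\<lambda>k. \<Sum>i\<le>k. (c i * z ^ i) * z ^ (k - i)) sums ((\<Sum>k. c k * z ^ k) * (\<Sum>k. z ^ k))"
    by (intro Cauchy_product_sums powser_abs_summable_in_unit_disc sums_summable[OF c] z)
       (use z in \<open>auto simp: norm_power\<close>)
  also have "(\<Sum>k. c k * z ^ k) * (\<Sum>k. z ^ k) = f z / (1 - z)"
    using c[OF z] geometric_sums[OF z] by (simp add: sums_iff)
  also have "(\<lambda>k. \<Sum>i\<le>k. (c i * z ^ i) * z ^ (k - i)) = (\<lambda>k. (\<Sum>j<Suc k. c j) * z ^ k)"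
    by (auto simp: sum_distrib_right lessThan_Suc_atMost mult.assoc simp flip: power_add
        intro!: sum.cong)
  finally have "(\<lambda>k. (\<Sum>j<Suc k. c j) * z ^ Suc k) sums (z * (f z / (1 - z)))"
    using sums_mult[of "\<lambda>k. (\<Sum>j<Suc k. c j) * z ^ k" "f z / (1 - z)" z] by (simp add: mult_ac)
  \<comment> \<open>The term that the shift adds at index 0 contains an empty sum.\<close>
  from sums_Suc[OF this] show ?thesis by simp
qed

text \<open>Termwise differentiation lowers every exponent by one, and the factor \<open>z\<close>
  restores it.\<close>

lemma powser_euler_deriv:
  fixes c :: "nat \<Rightarrow> complex"
  assumes c: "\<And>z. norm z < 1 \<Longrightarrow> (\<lambda>m. c m * z ^ m) sums f z" and z: "norm z < 1"
    and f': "(f has_field_derivative f') (at z)"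
  shows "(\<lambda>m. (of_nat m * c m) * z ^ m) sums (z * f')"
proof -
  have "(\<lambda>n. diffs c n * z ^ n) sums f'"
    by (rule termdiffs_sums_strong[where K = 1]) (use assms in auto)
  then have "(\<lambda>n. z * (diffs c n * z ^ n)) sums (z * f')" by (rule sums_mult)
  then have "(\<lambda>n. (of_nat (Suc n) * c (Suc n)) * z ^ Suc n) sums (z * f')"
    by (simp add: diffs_def mult_ac)
  from sums_Suc[OF this] show ?thesis by simp
qed

text \<open>The recursions \<open>chain_sum_snoc\<close> and \<open>polylog_poly_snoc\<close>
  correspond to each other. The outer induction adds a summation variable, the inner one a factor
  \<open>m\<close>, that is, one application of \<open>z d/dz\<close>.\<close>

lemma chain_sum_powser:
  assumes "norm z < 1"
  shows "(\<lambda>m. of_nat (chain_sum ks m) * z ^ m) sums poly (polylog_poly ks) (1 / (1 - z))"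
  using assms
proof (induction ks arbitrary: z rule: rev_induct)
  case Nil
  have "(\<lambda>m. if m = 0 then z ^ m else 0) sums z ^ 0" by (rule sums_single)
  also have "(\<lambda>m. if m = 0 then z ^ m else 0) = (\<lambda>m. of_nat (chain_sum [] m) * z ^ m)"
    by (auto simp: chain_sum_Nil)
  finally show ?case by simp
next
  case (snoc k ks)
  have "(\<lambda>m. (of_nat m ^ k * (\<Sum>j<m. of_nat (chain_sum ks j))) * z ^ m) sums
      poly (((\<lambda>q. [:0, -1, 1:] * pderiv q) ^^ k) ([:-1, 1:] * polylog_poly ks)) (1 / (1 - z))"
    using snoc.prems
  proof (induction k arbitrary: z)
    case 0
    then have "1 - z \<noteq> 0" by auto
    then have "poly [:-1, 1:] (1 / (1 - z)) = z / (1 - z)" by (simp add: field_simps)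
    then show ?case
      using powser_partial_sums[OF snoc.IH 0]
      by (simp only: poly_mult funpow_0 power_0 mult_1)
  next
    case (Suc k)
    let ?q = "((\<lambda>q. [:0, -1, 1:] * pderiv q) ^^ k) ([:-1, 1:] * polylog_poly ks)"
    have nz: "1 - z \<noteq> 0" using Suc.prems by auto
    have "((\<lambda>z. poly ?q (1 / (1 - z))) has_field_derivative
        poly (pderiv ?q) (1 / (1 - z)) * (1 / (1 - z)\<^sup>2)) (at z)"
      by (rule DERIV_chain2[OF poly_DERIV])
         (use nz in \<open>auto intro!: derivative_eq_intros simp: power2_eq_square\<close>)
    from powser_euler_deriv[OF Suc.IH Suc.prems this]
    have "(\<lambda>m. (of_nat m ^ Suc k * (\<Sum>j<m. of_nat (chain_sum ks j))) * z ^ m) sums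
        (z * (poly (pderiv ?q) (1 / (1 - z)) * (1 / (1 - z)\<^sup>2)))"
      by (simp add: mult_ac)
    \<comment> \<open>In terms of \<open>u = 1 / (1 - z)\<close> this is
      \<open>z * u ^ 2 = u * (u - 1)\<close>.\<close>
    also have "z * (poly (pderiv ?q) (1 / (1 - z)) * (1 / (1 - z)\<^sup>2)) =
        poly ([:0, -1, 1:] * pderiv ?q) (1 / (1 - z))"
      using nz by (simp add: field_simps power2_eq_square)
    finally show ?case by simp
  qed
  then show ?case by (simp add: polylog_poly_snoc chain_sum_snoc)
qed

section \<open>The polylogarithm as a polynomial in \<open>1 / (1 - z)\<close>\<close>

text \<open>Absolute summability allows the unordered sum over chains to be regrouped by the last
  entry, which gives the power series of \<open>chain_sum\<close>.\<close>

lemma multi_polylog_eq_poly: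
  assumes "ks \<noteq> []" "norm z < 1"
  shows "multi_polylog (neg_index ks) z = poly (polylog_poly ks) (1 / (1 - z))"
proof -
  let ?r = "length ks" and ?L = "poly (polylog_poly ks) (1 / (1 - z))"
  let ?f = "\<lambda>ms. of_nat (chain_weight ks ms) * z ^ last ms"
  \<comment> \<open>A chain for a nonempty index is nonempty, so the prefixed 0 does not affect its
    last entry.\<close>
  have last_eq: "last ms = m" if "ms \<in> chains_to ?r m" for ms m
    using that assms by (auto simp: chains_to_def increasing_chains_def split: if_splits)
  have bij: "bij_betw snd (Sigma UNIV (chains_to ?r)) (increasing_chains ?r)"
    by (auto simp: bij_betw_def inj_on_def chains_to_def image_def)
  have fib: "((\<lambda>ms. ?f (snd (m, ms))) has_sum of_nat (chain_sum ks m) * z ^ m)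
      (chains_to ?r m)" for m
    by (rule has_sum_finiteI) (auto simp: finite_chains_to chain_sum_def sum_distrib_right last_eq)
  \<comment> \<open>All terms of a fibre are nonnegative multiples of \<open>z ^ m\<close>, so their
    norms add up to the norm of their sum.\<close>
  have nfib: "((\<lambda>ms. norm (?f (snd (m, ms)))) has_sum norm (of_nat (chain_sum ks m) * z ^ m))
      (chains_to ?r m)" for m
  proof (rule has_sum_finiteI[OF finite_chains_to])
    have "norm (of_nat (chain_sum ks m) * z ^ m) = real (chain_sum ks m) * norm z ^ m"
      by (simp add: norm_mult norm_power)
    then show "norm (of_nat (chain_sum ks m) * z ^ m) =
        (\<Sum>ms\<in>chains_to ?r m. norm (?f (snd (m, ms))))"
      by (simp add: chain_sum_def sum_distrib_right last_eq norm_mult norm_power)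
  qed
  have abs: "summable (\<lambda>m. norm (of_nat (chain_sum ks m) * z ^ m))"
    using powser_abs_summable_in_unit_disc[OF sums_summable[OF chain_sum_powser] assms(2)] by simp
  have "(\<lambda>x. norm (?f (snd x))) summable_on Sigma UNIV (chains_to ?r)"
    by (rule summable_on_SigmaI[OF nfib]) (use abs in \<open>auto intro: summable_nonneg_imp_summable_on\<close>)
  then have summ: "(\<lambda>x. ?f (snd x)) summable_on Sigma UNIV (chains_to ?r)"
    by (rule abs_summable_summable)
  have "((\<lambda>x. ?f (snd x)) has_sum ?L) (Sigma UNIV (chains_to ?r))"
    by (rule has_sum_SigmaI[OF fib _ summ])
       (rule norm_summable_imp_has_sum[OF abs chain_sum_powser[OF assms(2)]])
  then have "(?f has_sum ?L) (increasing_chains ?r)"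
    using has_sum_reindex_bij_betw[OF bij, of ?f ?L] by simp
  moreover have "?f ms = z ^ last ms / (\<Prod>i<?r. of_nat (ms ! i) powi (neg_index ks ! i))" for ms
    by (simp add: chain_weight_def power_int_minus prod_dividef divide_inverse mult.commute
        flip: prod_inversef)
  ultimately show ?thesis
    by (simp add: multi_polylog_def infsumI)
qed

text \<open>The right-hand side is a witness for the choice operator. The chosen function must agree
  with it off 1, since both are rational and coincide on the unit disc.\<close>

lemma multi_polylog_rational_eq_poly:
  assumes "ks \<noteq> []" "z \<noteq> 1"
  shows "multi_polylog_rational (neg_index ks) z = poly (polylog_poly ks) (1 / (1 - z))"
proof -
  define P where "P = polylog_poly ks"
  define good where "good = (\<lambda>R. (\<exists>p N. \<forall>z. z \<noteq> 1 \<longrightarrow> R z = poly p z / (1 - z) ^ N) \<and>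
              (\<forall>z. norm z < 1 \<longrightarrow> R z = multi_polylog (neg_index ks) z))"
  \<comment> \<open>With \<open>w = 1 - z\<close>, reversing the coefficients of \<open>P\<close>
    writes \<open>P (1 / w)\<close> as a polynomial in \<open>w\<close> over
    \<open>w ^ degree P\<close>.\<close>
  have *: "poly P (1 / (1 - z)) = poly (pcompose (reflect_poly P) [:1, -1:]) z / (1 - z) ^ degree P"
    if "z \<noteq> 1" for z
    using poly_reflect_poly_nz[of "1 - z" P] that by (simp add: poly_pcompose inverse_eq_divide)
  have "good (\<lambda>z. poly P (1 / (1 - z)))"
    using * multi_polylog_eq_poly[OF assms(1)] unfolding good_def P_def by auto
  then have "good (multi_polylog_rational (neg_index ks))"
    unfolding multi_polylog_rational_def good_def[symmetric] by (rule someI[where P = good])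
  then obtain p N where
    p: "\<And>z. z \<noteq> 1 \<Longrightarrow> multi_polylog_rational (neg_index ks) z = poly p z / (1 - z) ^ N" and
    L: "\<And>z. norm z < 1 \<Longrightarrow> multi_polylog_rational (neg_index ks) z = poly P (1 / (1 - z))"
    unfolding good_def P_def using multi_polylog_eq_poly[OF assms(1)] by auto
  let ?q = "pcompose (reflect_poly P) [:1, -1:]"
  \<comment> \<open>This is the difference of the two fractions after cross-multiplication;
    infinitely many zeros make it the zero polynomial.\<close>
  let ?d = "p * [:1, -1:] ^ degree P - ?q * [:1, -1:] ^ N"
  have "poly ?d z = 0" if "z \<in> ball 0 1" for z
  proof -
    have "z \<noteq> 1" "norm z < 1" using that by auto
    then have "poly p z / (1 - z) ^ N = poly ?q z / (1 - z) ^ degree P"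
      using p L * by metis
    then show ?thesis using \<open>z \<noteq> 1\<close> by (simp add: frac_eq_eq)
  qed
  then have "ball 0 1 \<subseteq> {z. poly ?d z = 0}" by blast
  moreover have "infinite (ball (0::complex) 1)"
    using uncountable_ball[of 1 "0::complex"] countable_finite by auto
  ultimately have "infinite {z. poly ?d z = 0}" using finite_subset by blast
  then have "?d = 0" using poly_roots_finite by blast
  then have "poly ?d z = 0" by simp
  then have "poly p z * (1 - z) ^ degree P = poly ?q z * (1 - z) ^ N" by simp
  then have "poly p z / (1 - z) ^ N = poly ?q z / (1 - z) ^ degree P"
    using assms(2) by (simp add: frac_eq_eq)
  then show ?thesis using p * assms(2) by (simp add: P_def)
qed

section \<open>Finite Dirichlet series attached to polynomials\<close>

text \<open>The operator \<open>x d/dx\<close>; on functions of \<open>x = exp (- t)\<close> it acts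
  as \<open>- d/dt\<close>.\<close>

definition euler_deriv :: "complex poly \<Rightarrow> complex poly" where
  "euler_deriv q = pCons 0 (pderiv q)"

text \<open>This will be the Mellin transform of \<open>q (exp (- t))\<close> divided by
  \<open>Gamma s\<close>. The sum starts at 1 because decay at infinity requires the constant
  coefficient to be 0.\<close>

definition dirichlet_poly :: "complex poly \<Rightarrow> complex \<Rightarrow> complex" where
  "dirichlet_poly q s = (\<Sum>j=1..degree q. coeff q j * of_nat j powr (- s))"

lemma coeff_euler_deriv: "coeff (euler_deriv q) j = of_nat j * coeff q j"
  by (cases j) (simp_all add: euler_deriv_def coeff_pderiv)

lemma degree_euler_deriv_le: "degree (euler_deriv q) \<le> degree q"
  by (rule degree_le) (simp add: coeff_euler_deriv coeff_eq_0)

lemma sum_coeff_euler_deriv: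
  "(\<Sum>j=1..degree (euler_deriv q). coeff (euler_deriv q) j * f j) =
   (\<Sum>j=1..degree q. of_nat j * coeff q j * f j)"
  by (rule sum.mono_neutral_cong_left)
     (use degree_euler_deriv_le[of q] in \<open>auto simp flip: coeff_euler_deriv simp: coeff_eq_0\<close>)

text \<open>The factor \<open>j\<close> gained by the coefficient offsets the shift of
  \<open>s\<close>. This mirrors one integration by parts.\<close>

lemma dirichlet_poly_euler_deriv: "dirichlet_poly (euler_deriv q) (s + 1) = dirichlet_poly q s"
proof -
  have "of_nat j * coeff q j * of_nat j powr (- (s + 1)) = coeff q j * of_nat j powr (- s)"
    if "j \<ge> 1" for j
    using that powr_add[of "of_nat j :: complex" "- (s + 1)" 1] by simp
  then show ?thesis
    unfolding dirichlet_poly_def sum_coeff_euler_deriv by (intro sum.cong) auto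
qed

lemma poly_eq_sum_from_1:
  fixes q :: "complex poly"
  assumes "poly q 0 = 0"
  shows "poly q x = (\<Sum>j=1..degree q. coeff q j * x ^ j)"
proof -
  have "(\<Sum>j\<le>degree q. coeff q j * x ^ j) = (\<Sum>j=1..degree q. coeff q j * x ^ j)"
    by (rule sum.mono_neutral_right)
       (use assms in \<open>auto simp: poly_0_coeff_0 not_le\<close>)
  then show ?thesis by (simp add: poly_altdef)
qed

lemma dirichlet_poly_neg_nat:
  "dirichlet_poly q (- of_nat m) = (\<Sum>j=1..degree q. coeff q j * of_nat j ^ m)"
  unfolding dirichlet_poly_def by (intro sum.cong) (auto simp: powr_nat')

lemma power_dvd_pderiv:
  fixes q :: "complex poly"
  assumes "a ^ Suc d dvd q"
  shows "a ^ d dvd pderiv q"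
proof -
  obtain g where "q = a ^ Suc d * g" using assms by blast
  then have "pderiv q = a ^ d * (smult (of_nat (Suc d)) (pderiv a) * g + a * pderiv g)"
    by (simp only: pderiv_mult pderiv_power_Suc) (simp add: algebra_simps)
  then show ?thesis by simp
qed

text \<open>The factor \<open>a\<close> makes up for the power lost by differentiation. Hence
  \<open>u (u - 1) d/du\<close> does not lower the order of a zero at 1.\<close>

lemma power_dvd_mult_pderiv:
  fixes q :: "complex poly"
  assumes "a ^ d dvd q"
  shows "a ^ d dvd a * pderiv q"
  using power_dvd_pderiv[of a "d - 1" q] assms by (cases d) (auto intro: mult_dvd_mono)

lemma power_dvd_euler_deriv:
  assumes "a ^ Suc d dvd q"
  shows "a ^ d dvd euler_deriv q"
proof -
  have "euler_deriv q = [:0, 1:] * pderiv q" by (simp add: euler_deriv_def)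
  then show ?thesis using power_dvd_pderiv[OF assms] by (metis dvd_mult)
qed

lemma poly_euler_deriv_0 [simp]: "poly (euler_deriv q) 0 = 0"
  by (simp add: euler_deriv_def)

text \<open>The value at \<open>- m\<close> is that of \<open>(x d/dx) ^ m\<close> applied to
  \<open>q\<close> at 1, and fewer than \<open>d\<close> derivatives leave a zero there. This serves
  the poles of \<open>Gamma\<close> inside the half-plane.\<close>

lemma dirichlet_poly_neg_nat_eq_0:
  assumes "[:-1, 1:] ^ d dvd q" "poly q 0 = 0" "m < d"
  shows "dirichlet_poly q (- of_nat m) = 0"
  using assms
proof (induction m arbitrary: d q)
  case 0
  then have "[:-1, 1:] dvd q" by (metis dvd_power dvd_trans)
  then have "poly q 1 = 0" by (auto elim!: dvdE)
  then show ?case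
    using poly_eq_sum_from_1[OF 0(2), of 1] dirichlet_poly_neg_nat[of q 0] by simp
next
  case (Suc m)
  then obtain d' where d: "d = Suc d'" by (cases d) auto
  have "dirichlet_poly q (- of_nat (Suc m)) = dirichlet_poly (euler_deriv q) (- of_nat m)"
    using dirichlet_poly_euler_deriv[of q "- of_nat (Suc m)"] by simp
  also have "\<dots> = 0"
    by (rule Suc.IH[of d']) (use Suc.prems d power_dvd_euler_deriv in auto)
  finally show ?case .
qed

lemma dirichlet_poly_holomorphic [holomorphic_intros]: "dirichlet_poly q holomorphic_on A"
  unfolding dirichlet_poly_def by (intro holomorphic_intros) auto

section \<open>The Mellin transform of \<open>q (exp (- t))\<close>\<close>

text \<open>The zero at 1 contributes \<open>(1 - exp (- t)) ^ d \<le> t ^ d\<close>, the zero at 0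
  contributes \<open>exp (- t)\<close>, and the cofactor is bounded on the unit disc.\<close>

lemma poly_exp_bound:
  fixes q :: "complex poly"
  assumes "[:-1, 1:] ^ d dvd q" "poly q 0 = 0"
  obtains M where "M \<ge> 0"
    "\<And>t. t \<ge> 0 \<Longrightarrow> norm (poly q (exp (- of_real t))) \<le> M * t ^ d * exp (- t)"
proof -
  obtain g where g: "q = [:-1, 1:] ^ d * g" using assms(1) by blast
  with assms(2) have "poly g 0 = 0" by simp
  then have "[:0, 1:] dvd g" using poly_eq_0_iff_dvd[of g 0] by simp
  then obtain h where h: "g = [:0, 1:] * h" by blast
  have "bounded (poly h ` cball 0 1)"
    by (intro compact_imp_bounded compact_continuous_image continuous_intros compact_cball)
  then obtain M where M: "\<And>x. norm x \<le> 1 \<Longrightarrow> norm (poly h x) \<le> M"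
    unfolding bounded_iff by (metis dist_0_norm image_eqI mem_cball)
  show ?thesis
  proof
    show "M \<ge> 0" using order_trans[OF norm_ge_zero M[of 0]] by simp
    fix t :: real assume t: "t \<ge> 0"
    let ?e = "exp (- t)"
    have e: "exp (- complex_of_real t) = of_real ?e" by (simp flip: exp_of_real)
    have "norm (of_real ?e - 1 :: complex) = \<bar>?e - 1\<bar>"
      by (metis norm_of_real of_real_1 of_real_diff)
    also have "\<dots> = 1 - ?e" using t by simp
    also have "\<dots> \<le> t" using exp_ge_add_one_self[of "-t"] by linarith
    finally have "norm (of_real ?e - 1 :: complex) ^ d \<le> t ^ d" by (intro power_mono) auto
    moreover have "norm (poly h (of_real ?e)) \<le> M" using t by (intro M) simp
    ultimately have "norm (of_real ?e - 1 :: complex) ^ d * (?e * norm (poly h (of_real ?e)))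
        \<le> t ^ d * (?e * M)"
      by (intro mult_mono) (use t in auto)
    then show "norm (poly q (exp (- of_real t))) \<le> M * t ^ d * exp (- t)"
      unfolding e g h by (simp add: norm_mult norm_power mult_ac)
  qed
qed

lemma continuous_on_mellin_integrand:
  "continuous_on {0<..} (\<lambda>t. complex_of_real t powr s * poly q (exp (- of_real t)))"
  by (intro continuous_intros) auto

text \<open>By \<open>poly_exp_bound\<close> a multiple of the Gamma integrand at
  \<open>s + d\<close>, a point with positive real part, dominates the integrand.\<close>

lemma mellin_poly_exp_integrable:
  fixes q :: "complex poly"
  assumes "[:-1, 1:] ^ d dvd q" "poly q 0 = 0" "Re s > - real d"
  shows "set_integrable lborel {0<..}
           (\<lambda>t. of_real t powr (s - 1) * poly q (exp (- of_real t)))"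
proof -
  obtain M where M: "M \<ge> 0"
    "\<And>t. t \<ge> 0 \<Longrightarrow> norm (poly q (exp (- of_real t))) \<le> M * t ^ d * exp (- t)"
    using poly_exp_bound[OF assms(1,2)] by blast
  define z where "z = s + of_nat d"
  let ?g = "\<lambda>t. complex_of_real t powr (z - 1) / of_real (exp t)"
  have "set_integrable lebesgue {0<..} ?g"
    by (rule absolutely_integrable_Gamma_integral') (use assms in \<open>simp add: z_def\<close>)
  \<comment> \<open>As \<open>lebesgue\<close> is the completion of \<open>lborel\<close>, Borel
    measurability carries integrability over.\<close>
  moreover have "set_borel_measurable lborel {0<..} ?g"
    unfolding set_borel_measurable_def measurable_lborel2
    by (rule borel_measurable_continuous_on_indicator) (auto intro!: continuous_intros)
  ultimately have "set_integrable lborel {0<..} ?g"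
    unfolding set_integrable_def set_borel_measurable_def by (simp add: integrable_completion)
  then have "set_integrable lborel {0<..} (\<lambda>t. of_real M * ?g t)"
    by (rule set_integrable_mult_right)
  then show ?thesis
  proof (rule set_integrable_bound)
    show "set_borel_measurable lborel {0<..}
        (\<lambda>t. of_real t powr (s - 1) * poly q (exp (- of_real t)))"
      unfolding set_borel_measurable_def measurable_lborel2
      by (rule borel_measurable_continuous_on_indicator) (auto intro!: continuous_on_mellin_integrand)
    have "norm (of_real t powr (s - 1) * poly q (exp (- of_real t))) \<le> norm (of_real M * ?g t)"
      if t: "t > 0" for t
    proof -
      have "norm (of_real t powr (s - 1) * poly q (exp (- of_real t)))
          \<le> t powr (Re s - 1) * (M * t ^ d * exp (- t))"
        using M(2)[of t] t by (auto simp: norm_mult norm_powr_real_powr intro!: mult_left_mono)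
      also have "\<dots> = norm (of_real M * ?g t)"
        using t M(1) by (simp add: z_def norm_mult norm_divide norm_power norm_powr_real_powr powr_add
            powr_diff powr_realpow exp_minus field_simps)
      finally show ?thesis .
    qed
    then show "AE t in lborel. t \<in> {0<..} \<longrightarrow>
        norm (of_real t powr (s - 1) * poly q (exp (- of_real t))) \<le> norm (of_real M * ?g t)"
      by simp
  qed
qed

text \<open>Substitute \<open>j * t\<close> for \<open>t\<close> in the Gamma integral.\<close>

lemma Gamma_mellin_exp_power:
  assumes s: "Re s > 0" and j: "j \<ge> 1"
  shows "(LINT t:{0<..}|lborel. of_real t powr (s - 1) * exp (- complex_of_real t) ^ j) =
           Gamma s * of_nat j powr (- s)"
proof -
  let ?f = "\<lambda>t. of_real t powr (s - 1) * poly [:0, 1:] (exp (- complex_of_real t))"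
  \<comment> \<open>Integrability identifies the Lebesgue integral with the gauge integral, for
    which the Gamma formula is stated.\<close>
  have "set_integrable lborel {0<..} ?f"
    by (rule mellin_poly_exp_integrable[where d = 0]) (use s in auto)
  then have "(LINT t:{0<..}|lborel. ?f t) = integral {0<..} ?f"
    by (rule set_borel_integral_eq_integral)
  also have "integral {0<..} ?f = integral {0<..} (\<lambda>t. of_real t powr (s - 1) / of_real (exp t))"
    by (simp add: exp_minus exp_of_real divide_inverse)
  also have "\<dots> = Gamma s"
    using Gamma_integral_complex'[OF s] by (rule integral_unique)
  finally have "Gamma s = (LINT t|lborel. indicator {0<..} t *\<^sub>R ?f t)"
    unfolding set_lebesgue_integral_def by (rule sym)
  also have "\<dots> = real j *\<^sub>R (LINT t|lborel. indicator {0<..} (0 + real j * t) *\<^sub>R ?f (0 + real j * t))"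
    using j by (subst lborel_integral_real_affine[where c = "real j" and t = 0]) auto
  also have "(\<lambda>t. indicator {0<..} (0 + real j * t) *\<^sub>R ?f (0 + real j * t)) =
      (\<lambda>t. of_nat j powr (s - 1) *
        (indicator {0<..} t *\<^sub>R (of_real t powr (s - 1) * exp (- complex_of_real t) ^ j)))"
    using j by (auto simp: indicator_def fun_eq_iff powr_times_real zero_less_mult_iff
        simp flip: exp_of_nat_mult)
  finally have "Gamma s = of_nat j * of_nat j powr (s - 1) *
      (LINT t:{0<..}|lborel. of_real t powr (s - 1) * exp (- complex_of_real t) ^ j)"
    by (simp add: set_lebesgue_integral_def scaleR_conv_of_real)
  also have "of_nat j * of_nat j powr (s - 1) = (of_nat j powr s :: complex)"
    using j by (simp add: powr_diff)
  finally show ?thesis using j by (simp add: powr_minus field_simps)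
qed

lemma powr_exp_tendsto_0:
  fixes a :: real
  assumes "a > 0"
  shows "((\<lambda>t. t powr a * exp (- t)) \<longlongrightarrow> 0) (at_right 0)"
    "((\<lambda>t. t powr a * exp (- t)) \<longlongrightarrow> 0) at_top"
  using assms by real_asymp+

text \<open>For \<open>d = 0\<close> the integral is taken termwise. Each further zero at 1 pays for
  one integration by parts, which trades \<open>q\<close> and \<open>s\<close> for
  \<open>euler_deriv q\<close> and \<open>s + 1\<close> and so widens the half-plane by one.\<close>

lemma mellin_poly_exp:
  fixes q :: "complex poly"
  assumes "[:-1, 1:] ^ d dvd q" "poly q 0 = 0" "Re s > - real d" "s \<notin> \<int>\<^sub>\<le>\<^sub>0"
  shows "(LINT t:{0<..}|lborel. of_real t powr (s - 1) * poly q (exp (- complex_of_real t))) =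
           Gamma s * dirichlet_poly q s"
  using assms
proof (induction d arbitrary: q s)
  case 0
  then have s: "Re s > 0" by simp
  let ?h = "\<lambda>j t. indicator {0<..} t *\<^sub>R (of_real t powr (s - 1) * exp (- complex_of_real t) ^ j)"
  have int: "integrable lborel (?h j)" if "j \<ge> 1" for j
    using mellin_poly_exp_integrable[of 0 "monom 1 j" s] that s
    by (simp add: set_integrable_def poly_monom)
  have "(LINT t:{0<..}|lborel. of_real t powr (s - 1) * poly q (exp (- complex_of_real t))) =
      (LINT t|lborel. (\<Sum>j=1..degree q. coeff q j * ?h j t))"
    by (simp add: set_lebesgue_integral_def poly_eq_sum_from_1[OF 0(2)] sum_distrib_left
        scaleR_sum_right mult_ac)
  also have "\<dots> = (\<Sum>j=1..degree q. LINT t|lborel. coeff q j * ?h j t)"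
    by (intro Bochner_Integration.integral_sum integrable_mult_right int) auto
  also have "\<dots> = (\<Sum>j=1..degree q. coeff q j * (Gamma s * of_nat j powr (- s)))"
  proof (intro sum.cong refl)
    fix j assume "j \<in> {1..degree q}"
    then show "(LINT t|lborel. coeff q j * ?h j t) = coeff q j * (Gamma s * of_nat j powr (- s))"
      using Gamma_mellin_exp_power[OF s, of j]
      by (subst integral_mult_right_zero) (simp add: set_lebesgue_integral_def)
  qed
  finally show ?case by (simp add: dirichlet_poly_def sum_distrib_left mult_ac)
next
  case (Suc d)
  let ?e = "\<lambda>t. exp (- complex_of_real t)"
  let ?I = "\<lambda>t. of_real t powr (s - 1) * poly q (?e t)"
  let ?J = "\<lambda>t. of_real t powr s * poly (euler_deriv q) (?e t)"
  \<comment> \<open>The function to which the fundamental theorem is applied: its derivative is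
    \<open>s * ?I t - ?J t\<close>.\<close>
  let ?F = "\<lambda>t. of_real t powr s * poly q (?e t)"
  have s0: "s \<noteq> 0" using Suc.prems by auto
  have dvd: "[:-1, 1:] ^ d dvd euler_deriv q"
    using power_dvd_euler_deriv Suc.prems(1) .
  have I: "set_integrable lborel {0<..} ?I"
    using mellin_poly_exp_integrable[OF Suc.prems(1-3)] .
  have J: "set_integrable lborel {0<..} ?J"
    using mellin_poly_exp_integrable[OF dvd, of "s + 1"] Suc.prems by simp
  have "(LINT t:{0<..}|lborel. ?J t) = Gamma (s + 1) * dirichlet_poly (euler_deriv q) (s + 1)"
    using Suc.IH[OF dvd, of "s + 1"] Suc.prems plus_one_in_nonpos_Ints_imp[of s] by auto
  then have J_eq: "(LINT t:{0<..}|lborel. ?J t) = s * (Gamma s * dirichlet_poly q s)"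
    using Suc.prems by (simp add: dirichlet_poly_euler_deriv Gamma_plus1 mult_ac)
  obtain M where M: "M \<ge> 0"
    "\<And>t. t \<ge> 0 \<Longrightarrow> norm (poly q (?e t)) \<le> M * t ^ Suc d * exp (- t)"
    using poly_exp_bound[OF Suc.prems(1,2)] by blast
  \<comment> \<open>Positivity of \<open>a\<close> is exactly the condition on \<open>Re s\<close>;
    it makes the boundary term at 0 vanish.\<close>
  define a where "a = Re s + real (Suc d)"
  have a: "a > 0" using Suc.prems by (simp add: a_def)
  have F_bound: "norm (?F t) \<le> M * (t powr a * exp (- t))" if t: "t > 0" for t
  proof -
    have "norm (?F t) \<le> t powr Re s * (M * t ^ Suc d * exp (- t))"
      using M(2)[of t] t
      by (auto simp: norm_mult norm_powr_real_powr simp del: power_Suc intro!: mult_left_mono)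
    also have "\<dots> = M * (t powr a * exp (- t))"
      using t by (simp add: a_def powr_add powr_realpow del: of_nat_Suc power_Suc)
    finally show ?thesis .
  qed
  have lim0: "(?F \<longlongrightarrow> 0) (at_right 0)"
    by (rule Lim_null_comparison[OF _ tendsto_mult_right_zero[OF powr_exp_tendsto_0(1)[OF a], of M]])
       (use F_bound in \<open>auto intro!: eventually_mono[OF eventually_at_right_less]\<close>)
  have lim_top: "(?F \<longlongrightarrow> 0) at_top"
    by (rule Lim_null_comparison[OF _ tendsto_mult_right_zero[OF powr_exp_tendsto_0(2)[OF a], of M]])
       (use F_bound in \<open>auto intro!: eventually_mono[OF eventually_gt_at_top[of 0]]\<close>)
  have deriv: "(?F has_vector_derivative s * ?I t - ?J t) (at t)" if t: "t > 0" for t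
  proof -
    have e': "(?e has_vector_derivative - ?e t) (at t)"
      by (rule has_vector_derivative_real_field) (auto intro!: derivative_eq_intros)
    have p': "((\<lambda>t. of_real t powr s) has_vector_derivative s * of_real t powr (s - 1)) (at t)"
      by (rule has_vector_derivative_real_field) (use t in \<open>auto intro!: has_field_derivative_powr\<close>)
    have "((\<lambda>t. poly q (?e t)) has_vector_derivative - ?e t * poly (pderiv q) (?e t)) (at t)"
      using field_vector_diff_chain_at[OF e' poly_DERIV[of q]] by (simp add: o_def)
    from has_vector_derivative_mult[OF p' this] show ?thesis
      by (simp add: euler_deriv_def algebra_simps)
  qed
  have "(LBINT t=0..\<infinity>. s * ?I t - ?J t) = 0 - 0"
  proof (rule interval_integral_FTC_integrable[where F = ?F])
    show "isCont (\<lambda>t. s * ?I t - ?J t) t" if "0 < ereal t" for t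
    proof -
      have "continuous_on {0<..} (\<lambda>t. s * ?I t - ?J t)"
        by (intro continuous_intros continuous_on_mellin_integrand)
      then show ?thesis using that by (auto simp: continuous_on_eq_continuous_at)
    qed
    have "einterval 0 \<infinity> = {0<..}" by (auto simp: einterval_def)
    then show "set_integrable lborel (einterval 0 \<infinity>) (\<lambda>t. s * ?I t - ?J t)"
      using I J by simp
    show "((?F \<circ> real_of_ereal) \<longlongrightarrow> 0) (at_right 0)"
      unfolding zero_ereal_def using lim0 by (simp add: ereal_tendsto_simps)
    show "((?F \<circ> real_of_ereal) \<longlongrightarrow> 0) (at_left \<infinity>)"
      using lim_top by (simp add: ereal_tendsto_simps)
  qed (use deriv in auto)
  then have "(LINT t:{0<..}|lborel. s * ?I t - ?J t) = 0"
    by (simp add: interval_integral_Ioi)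
  then have "s * (LINT t:{0<..}|lborel. ?I t) = (LINT t:{0<..}|lborel. ?J t)"
    using I J by (simp add: set_integral_diff)
  then show ?case using J_eq s0 by simp
qed

section \<open>Zeros of the polylogarithm polynomial at 1 and 0\<close>

text \<open>Every entry contributes one factor \<open>u - 1\<close>, and
  \<open>u (u - 1) d/du\<close> preserves those already present.\<close>

lemma power_dvd_polylog_poly: "[:-1, 1:] ^ length ks dvd polylog_poly ks"
proof (induction ks rule: rev_induct)
  case (snoc k ks)
  let ?a = "[:-1, 1:] :: complex poly" and ?T = "\<lambda>q :: complex poly. [:0, -1, 1:] * pderiv q"
  have T: "?a ^ n dvd ?T q" if "?a ^ n dvd q" for q n
  proof -
    have "?T q = [:0, 1:] * (?a * pderiv q)" by simp
    then show ?thesis using power_dvd_mult_pderiv[OF that] by (metis dvd_mult)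
  qed
  have "?a ^ length (ks @ [k]) dvd (?T ^^ k) (?a * polylog_poly ks)"
  proof (induction k)
    case 0
    show ?case using mult_dvd_mono[OF dvd_refl snoc.IH, of ?a] by (simp del: mult_pCons_left)
  next
    case (Suc k)
    then have "?a ^ length (ks @ [k]) dvd ?T ((?T ^^ k) (?a * polylog_poly ks))" by (rule T)
    then show ?case by (simp only: funpow.simps o_apply length_append list.size)
  qed
  then show ?case by (simp only: polylog_poly_snoc)
qed simp

text \<open>A positive entry brings in the outer factor \<open>u\<close> of
  \<open>u (u - 1) d/du\<close>, and later entries keep the zero at 0. For the index (0, ..., 0) the
  polynomial is \<open>(u - 1) ^ r\<close>, which does not vanish there.\<close>

lemma poly_polylog_poly_0:
  assumes "\<exists>k\<in>set ks. k \<noteq> 0"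
  shows "poly (polylog_poly ks) 0 = 0"
  using assms
proof (induction ks rule: rev_induct)
  case (snoc k ks)
  show ?case
  proof (cases k)
    case 0
    with snoc show ?thesis by (simp add: polylog_poly_snoc)
  qed (simp add: polylog_poly_snoc)
qed simp

section \<open>Multi-poly-Bernoulli numbers as Taylor coefficients\<close>

lemma powser_eventually_unique:
  fixes c d :: "nat \<Rightarrow> complex"
  assumes "\<forall>\<^sub>F t in at 0. (\<lambda>n. c n * t ^ n) sums f t" "\<forall>\<^sub>F t in at 0. (\<lambda>n. d n * t ^ n) sums f t"
  shows "c = d"
proof (rule ccontr)
  assume "c \<noteq> d"
  then obtain m where m: "c m - d m \<noteq> 0" by auto
  have "\<forall>\<^sub>F t in at 0. (\<lambda>n. (c n - d n) * t ^ n) sums 0"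
    using assms by eventually_elim (use sums_diff in \<open>fastforce simp: algebra_simps\<close>)
  then obtain r where r: "r > 0"
    and sums: "\<And>t. t \<noteq> 0 \<Longrightarrow> norm t < r \<Longrightarrow> (\<lambda>n. (c n - d n) * t ^ n) sums 0"
    by (auto simp: eventually_at)
  \<comment> \<open>The assumptions say nothing about \<open>t = 0\<close>, so the constant
    coefficient is found as a limit.\<close>
  have c0: "c 0 - d 0 = 0"
    using powser_limit_0_strong[OF r sums] by (simp add: tendsto_const_iff)
  then have "m > 0" using m by (cases m) auto
  have sums0: "(\<lambda>n. (c n - d n) * (t - 0) ^ n) sums 0" if "norm (t - 0) < r" for t
    using sums[of t] that powser_sums_zero[of "\<lambda>n. c n - d n"] c0 by (cases "t = 0") auto
  show False
  \<comment> \<open>Zeros of a nontrivial power series are isolated, which would make the zero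
    function nonzero near 0.\<close>
  proof (rule powser_0_nonzero[where f = "\<lambda>_. 0" and \<xi> = 0 and a = "\<lambda>n. c n - d n", OF r])
    fix s :: real
    assume "s > 0" and nz: "\<And>z :: complex. z \<in> cball 0 s - {0} \<Longrightarrow> (0::complex) \<noteq> 0"
    then show False using nz[of "of_real s"] by simp
  qed (rule sums0 refl m \<open>m > 0\<close> | assumption)+
qed

text \<open>A monomial of degree \<open>j\<close> becomes \<open>exp (j * t)\<close>, whose Taylor
  coefficients carry \<open>j ^ n\<close>.\<close>

lemma poly_exp_powser:
  fixes q :: "complex poly"
  assumes "poly q 0 = 0"
  shows "(\<lambda>n. dirichlet_poly q (- of_nat n) * t ^ n / fact n) sums poly q (exp t)"
proof -
  have "(\<lambda>n. coeff q j * ((of_nat j * t) ^ n /\<^sub>R fact n)) sums (coeff q j * exp (of_nat j * t))" for j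
    by (intro sums_mult exp_converges)
  then have "(\<lambda>n. \<Sum>j=1..degree q. coeff q j * ((of_nat j * t) ^ n /\<^sub>R fact n)) sums
      (\<Sum>j=1..degree q. coeff q j * exp (of_nat j * t))"
    by (rule sums_sum)
  also have "(\<Sum>j=1..degree q. coeff q j * exp (of_nat j * t)) = poly q (exp t)"
    by (simp add: poly_eq_sum_from_1[OF assms] exp_of_nat_mult)
  also have "(\<lambda>n. \<Sum>j=1..degree q. coeff q j * ((of_nat j * t) ^ n /\<^sub>R fact n)) =
      (\<lambda>n. dirichlet_poly q (- of_nat n) * t ^ n / fact n)"
    unfolding dirichlet_poly_neg_nat sum_distrib_right sum_divide_distrib
    by (intro ext sum.cong refl) (simp add: power_mult_distrib scaleR_conv_of_real field_simps)
  finally show ?thesis .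
qed

text \<open>At \<open>z = 1 - exp (- t)\<close> one has \<open>1 / (1 - z) = exp t\<close>, so
  cancelling \<open>exp t - 1\<close> leaves \<open>q (exp t)\<close>. Uniqueness of power series
  then evaluates the definite description.\<close>

lemma multi_poly_bernoulli_C_eq:
  assumes "ks \<noteq> []" and P: "polylog_poly ks = [:-1, 1:] * q" and q0: "poly q 0 = 0"
  shows "multi_poly_bernoulli_C (neg_index ks) m = dirichlet_poly q (- of_nat m)"
proof -
  let ?c = "\<lambda>n. dirichlet_poly q (- of_nat n)"
  let ?f = "\<lambda>t. multi_polylog_rational (neg_index ks) (1 - exp (- t)) / (exp t - 1)"
  have "\<forall>\<^sub>F t in at (0::complex). exp t \<noteq> 1"
  proof -
    \<comment> \<open>The exponential is injective on the disc of radius \<open>pi\<close> around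
      0.\<close>
    have "exp t \<noteq> 1" if "t \<noteq> 0" "dist t 0 < pi" for t :: complex
      using inj_onD[OF inj_on_exp_pi[of 0], of t 0] that by (auto simp: dist_commute)
    then show ?thesis by (auto simp: eventually_at intro!: exI[of _ pi])
  qed
  then have c: "\<forall>\<^sub>F t in at 0. (\<lambda>n. ?c n * t ^ n / fact n) sums ?f t"
  proof eventually_elim
    case (elim t)
    have "?f t = poly q (exp t)"
      using elim by (simp add: multi_polylog_rational_eq_poly[OF assms(1)] P exp_minus field_simps)
    then show ?case using poly_exp_powser[OF q0, of t] by simp
  qed
  have "multi_poly_bernoulli_C (neg_index ks) = ?c"
    unfolding multi_poly_bernoulli_C_def
  proof (rule the_equality)
    show "\<forall>\<^sub>F t in at 0. (\<lambda>n. ?c n * t ^ n / fact n) sums ?f t" by (rule c)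
    fix d :: "nat \<Rightarrow> complex"
    assume "\<forall>\<^sub>F t in at 0. (\<lambda>n. d n * t ^ n / fact n) sums ?f t"
    then have "(\<lambda>n. d n / fact n) = (\<lambda>n. ?c n / fact n)"
      using c by (intro powser_eventually_unique[where f = ?f]) (simp_all add: field_simps)
    then show "d = ?c" by (auto simp: fun_eq_iff)
  qed
  then show ?thesis by simp
qed

section \<open>Continuation of the integral and its values\<close>

text \<open>Here \<open>z = 1 - exp t\<close>, so \<open>1 / (1 - z) = exp (- t)\<close>, and the
  denominator cancels the factor \<open>u - 1\<close>.\<close>

lemma xi_tilde_integrand_eq:
  assumes "ks \<noteq> []" "polylog_poly ks = [:-1, 1:] * q" "t > 0"
  shows "xi_tilde_integrand (neg_index ks) s t =
           of_real t powr (s - 1) * poly q (exp (- of_real t))"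
proof -
  have "exp (- complex_of_real t) = of_real (exp (- t))" by (simp flip: exp_of_real)
  then have "exp (- complex_of_real t) \<noteq> 1"
    using assms(3) by (metis exp_eq_one_iff neg_equal_0_iff_equal of_real_eq_1_iff less_irrefl)
  then show ?thesis
    by (simp add: xi_tilde_integrand_def multi_polylog_rational_eq_poly assms(1,2) exp_minus
        field_simps)
qed

lemma xi_tilde_continuation:
  assumes "\<exists>k\<in>set ks. k \<noteq> 0"
  shows "(\<forall>s. Re s > 1 - real (length ks) \<longrightarrow>
            set_integrable lborel {0<..} (xi_tilde_integrand (neg_index ks) s)) \<and>
         (\<exists>F :: complex \<Rightarrow> complex.
            F holomorphic_on UNIV \<and>
            (\<forall>s. Re s > 1 - real (length ks) \<longrightarrow> F s = xi_tilde_integral (neg_index ks) s) \<and>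
            (\<forall>m::nat. F (- of_nat m) = multi_poly_bernoulli_C (neg_index ks) m))"
proof -
  have ks: "ks \<noteq> []" using assms by auto
  \<comment> \<open>The denominator uses up one of the \<open>r\<close> zeros at 1. The remaining
    \<open>d\<close> give the half-plane \<open>Re s > - d\<close>, which is
    \<open>Re s > 1 - r\<close>.\<close>
  define d where "d = length ks - 1"
  have d: "length ks = Suc d" using ks by (cases ks) (auto simp: d_def)
  obtain g where g: "polylog_poly ks = [:-1, 1:] ^ Suc d * g"
    using power_dvd_polylog_poly[of ks] unfolding d by blast
  define q where "q = [:-1, 1:] ^ d * g"
  have P: "polylog_poly ks = [:-1, 1:] * q" unfolding g q_def by (simp only: power_Suc mult.assoc)
  have q: "[:-1, 1:] ^ d dvd q" by (simp add: q_def)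
  have q0: "poly q 0 = 0" using poly_polylog_poly_0[OF assms] unfolding P by simp
  let ?h = "\<lambda>s t. of_real t powr (s - 1) * poly q (exp (- complex_of_real t))"
  note eq = xi_tilde_integrand_eq[OF ks P]
  have int: "set_integrable lborel {0<..} (xi_tilde_integrand (neg_index ks) s)"
    if "Re s > 1 - real (length ks)" for s
  proof -
    have "set_integrable lborel {0<..} (?h s)"
      by (rule mellin_poly_exp_integrable[OF q q0]) (use that d in auto)
    then show ?thesis
      by (subst set_integrable_cong[OF refl refl eq]) auto
  qed
  have F: "dirichlet_poly q s = xi_tilde_integral (neg_index ks) s"
    if s: "Re s > 1 - real (length ks)" for s
  proof (cases "s \<in> \<int>\<^sub>\<le>\<^sub>0")
    case True \<comment> \<open>At a pole HOL has \<open>Gamma s = 0\<close>, hence \<open>1 / Gamma s = 0\<close>.\<close>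
    then obtain m where m: "s = - of_nat m" by (elim nonpos_Ints_cases') auto
    \<comment> \<open>The poles of \<open>Gamma\<close> in the half-plane are those with
      \<open>m < d\<close>, where the zero of \<open>q\<close> at 1 makes the Dirichlet polynomial
      vanish too.\<close>
    with s d have "m < d" by simp
    then have "dirichlet_poly q s = 0"
      unfolding m by (rule dirichlet_poly_neg_nat_eq_0[OF q q0])
    moreover have "Gamma s = 0" using True by (simp add: Gamma_eq_zero_iff)
    ultimately show ?thesis by (simp add: xi_tilde_integral_def)
  next
    case False
    have "(LINT t:{0<..}|lborel. xi_tilde_integrand (neg_index ks) s t) =
        (LINT t:{0<..}|lborel. ?h s t)"
      by (rule set_lebesgue_integral_cong) (auto simp: eq)
    also have "\<dots> = Gamma s * dirichlet_poly q s"
      by (rule mellin_poly_exp[OF q q0 _ False]) (use s d in auto)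
    finally show ?thesis
      using False by (simp add: xi_tilde_integral_def Gamma_eq_zero_iff)
  qed
  show ?thesis
    using int F multi_poly_bernoulli_C_eq[OF ks P q0] dirichlet_poly_holomorphic[of q UNIV]
    by (intro conjI allI impI exI[of _ "dirichlet_poly q"]) auto
qed

theorem theorem4p6:
  fixes ks :: "nat list"
  assumes "\<exists>k\<in>set ks. k \<noteq> 0"
  shows "(\<forall>s. Re s > 1 - real (length ks) \<longrightarrow>
            set_integrable lborel {0<..} (xi_tilde_integrand (neg_index ks) s)) \<and>
         (\<exists>F :: complex \<Rightarrow> complex.
            F holomorphic_on UNIV \<and>
            (\<forall>s. Re s > 1 - real (length ks) \<longrightarrow> F s = xi_tilde_integral (neg_index ks) s) \<and>
            (\<forall>m::nat. F (- of_nat m) = multi_poly_bernoulli_C (neg_index ks) m)) \<and>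
         (\<forall>k::nat. k \<ge> 1 \<longrightarrow>
            (\<exists>F :: complex \<Rightarrow> complex.
               F holomorphic_on UNIV \<and>
               (\<forall>s. Re s > 0 \<longrightarrow> F s = xi_tilde_integral [- int k] s) \<and>
               (\<forall>m::nat. F (- of_nat m) = multi_poly_bernoulli_C [- int k] m)))"
proof -
  have "\<exists>F :: complex \<Rightarrow> complex.
      F holomorphic_on UNIV \<and>
      (\<forall>s. Re s > 0 \<longrightarrow> F s = xi_tilde_integral [- int k] s) \<and>
      (\<forall>m::nat. F (- of_nat m) = multi_poly_bernoulli_C [- int k] m)" if "k \<ge> 1" for k
    using xi_tilde_continuation[of "[k]"] that by simp
  then show ?thesis using xi_tilde_continuation[OF assms] by blast
qed

end
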